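(* Let $S=\{z\in\mathbb{C}:|z|=1\}$. Any continuous function $f:S\to\mathbb{C}$ is the difference $f=f_1-f_2$ of two continuous functions $f_1,f_2:S\to\mathbb{C}$ whose graphs $\Gamma_{f_i}=\{(z,f_i(z))\in\mathbb{C}^2:z\in S\}$, $i=1,2$, are pluripolar in $\mathbb{C}^2$.
   Context: A set $K\subset\mathbb{C}^n$ is pluripolar if there is a plurisubharmonic function $u\not\equiv-\infty$ on $\mathbb{C}^n$ which is equal to $-\infty$ on $K$. *)

theory Defs
  imports "HOL-Analysis.Analysis"
begin

definition upper_semicontinuous :: "('a::topological_space \<Rightarrow> ereal) \<Rightarrow> bool" where
  "upper_semicontinuous u \<longleftrightarrow> (\<forall>c. open {x. u x < c})"

text \<open>
  The mean of \<open>u\<close> over the circle with centre \<open>a\<close> and radius \<open>r\<close>, i.e.\ the integral of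
  \<open>u (a + r e\<^sup>i\<^sup>t)\<close> over \<open>0 \<le> t \<le> 2\<pi>\<close>, divided by \<open>2\<pi>\<close>. Since \<open>e2ennreal\<close>
  sends negative values to 0, the two integrals are those of the positive and of the negative part
  of \<open>u\<close>. For upper semicontinuous \<open>u < \<infinity>\<close> the first one is finite, so that the difference is the
  usual integral with values in \<open>[-\<infinity>, \<infinity>)\<close>.
\<close>

definition circle_mean :: "(complex \<Rightarrow> ereal) \<Rightarrow> complex \<Rightarrow> real \<Rightarrow> ereal" where
  "circle_mean u a r =
     (enn2ereal (\<integral>\<^sup>+t\<in>{0..2 * pi}. e2ennreal (u (a + of_real r * cis t)) \<partial>lborel)
      - enn2ereal (\<integral>\<^sup>+t\<in>{0..2 * pi}. e2ennreal (- u (a + of_real r * cis t)) \<partial>lborel))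
     / ereal (2 * pi)"

lemma circle_mean_real:
  assumes "set_integrable lborel {0..2 * pi} (\<lambda>t. v (a + of_real r * cis t))"
  shows "circle_mean (\<lambda>z. ereal (v z)) a r
       = ereal ((LINT t:{0..2 * pi}|lborel. v (a + of_real r * cis t)) / (2 * pi))"
proof -
  let ?g = "\<lambda>t. indicator {0..2 * pi} t * v (a + of_real r * cis t)"
  have g: "integrable lborel ?g"
    using assms by (simp add: set_integrable_def)
  have e: "e2ennreal (ereal x) = ennreal x" for x
    by (simp add: ennreal.abs_eq e2ennreal_def ennreal_def)
  have P: "(\<integral>\<^sup>+t\<in>{0..2 * pi}. e2ennreal (ereal (v (a + of_real r * cis t))) \<partial>lborel)
      = (\<integral>\<^sup>+t. ennreal (?g t) \<partial>lborel)"
    by (intro nn_integral_cong) (simp add: e split: split_indicator)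
  have N: "(\<integral>\<^sup>+t\<in>{0..2 * pi}. e2ennreal (- ereal (v (a + of_real r * cis t))) \<partial>lborel)
      = (\<integral>\<^sup>+t. ennreal (- ?g t) \<partial>lborel)"
    by (intro nn_integral_cong) (simp add: e split: split_indicator)
  have fin: "(\<integral>\<^sup>+t. ennreal (?g t) \<partial>lborel) \<noteq> \<infinity>" "(\<integral>\<^sup>+t. ennreal (- ?g t) \<partial>lborel) \<noteq> \<infinity>"
    using g by (auto simp: real_integrable_def)
  have en: "enn2ereal x = ereal (enn2real x)" if "x \<noteq> \<infinity>" for x
    using that by (cases x) auto
  show ?thesis
    unfolding circle_mean_def P N en[OF fin(1)] en[OF fin(2)]
    by (simp add: set_lebesgue_integral_def real_lebesgue_integral_def[OF g])
qed

text \<open>The constant \<open>-\<infinity>\<close> counts as subharmonic and as plurisubharmonic.\<close>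

definition subharmonic :: "(complex \<Rightarrow> ereal) \<Rightarrow> bool" where
  "subharmonic u \<longleftrightarrow> upper_semicontinuous u \<and> (\<forall>z. u z < \<infinity>) \<and>
     (\<forall>a r. 0 < r \<longrightarrow> u a \<le> circle_mean u a r)"

definition plurisubharmonic :: "(complex ^ 'n \<Rightarrow> ereal) \<Rightarrow> bool" where
  "plurisubharmonic u \<longleftrightarrow> upper_semicontinuous u \<and> (\<forall>z. u z < \<infinity>) \<and>
     (\<forall>a b. subharmonic (\<lambda>\<zeta>. u (a + \<zeta> *s b)))"

definition pluripolar :: "(complex ^ 'n) set \<Rightarrow> bool" where
  "pluripolar K \<longleftrightarrow>
     (\<exists>u. plurisubharmonic u \<and> (\<exists>z. u z \<noteq> -\<infinity>) \<and> (\<forall>z\<in>K. u z = -\<infinity>))"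

definition graph_over :: "complex set \<Rightarrow> (complex \<Rightarrow> complex) \<Rightarrow> (complex ^ 2) set" where
  "graph_over S f = {vector [z, f z] | z. z \<in> S}"

end

theory Submission
  imports Defs "HOL-Complex_Analysis.Conformal_Mappings"
begin

text \<open>
  Suppose that \<open>x\<close> is approximated on the circle so closely by Laurent polynomials \<open>p / z\<^sup>m\<close> that
  the negative numbers \<open>ln \<bar>z\<^sup>m w - p(z)\<bar>\<close> on its graph dwarf the bounds of \<open>z\<^sup>m w - p(z)\<close> on large
  balls. Then a suitable sum of the functions \<open>max (c (ln \<bar>z\<^sup>m w - p(z)\<bar> - A)) (-1)\<close>
  is plurisubharmonic and equal to \<open>-\<infinity>\<close> on the graph. As in the theorem of Erdos that every
  real number is a sum of two Liouville numbers, the functions \<open>x\<close> with this property form a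
  dense \<open>G\<^sub>\<delta>\<close> set in the space of continuous functions on the circle, which therefore meets its
  translate by \<open>f\<close>.
\<close>

section \<open>Laurent and harmonic polynomial approximation on the unit circle\<close>

text \<open>On the unit circle \<open>cnj z = 1 / z\<close>, so \<open>Re z\<close> and
  \<open>Im z\<close> are Laurent polynomials in \<open>z\<close>. These are closed under sums and
  products, and a factor \<open>z ^ m\<close> clears the denominator.\<close>

lemma real_polynomial_function_on_circle:
  fixes h :: "complex \<Rightarrow> real"
  assumes "real_polynomial_function h"
  shows "\<exists>m p. \<forall>z. cmod z = 1 \<longrightarrow> z ^ m * of_real (h z) = poly p z"
  using assms
proof (induction rule: real_polynomial_function.induct)
  case (linear h)
  then interpret bounded_linear h .
  \<comment> \<open>Obtained from \<open>h z = Re z * h 1 + Im z * h \<i>\<close> by inserting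
    \<open>Re z = (z + 1 / z) / 2\<close> and \<open>Im z = (z - 1 / z) / (2 * \<i>)\<close> and
    multiplying by \<open>z\<close>.\<close>
  let ?p = "smult (1 / 2) [:of_real (h 1) + \<i> * of_real (h \<i>), 0, of_real (h 1) - \<i> * of_real (h \<i>):]"
  have "z ^ 1 * of_real (h z) = poly ?p z" if "cmod z = 1" for z
  proof -
    have zc: "z * cnj z = 1"
      using that complex_norm_square[of z] by simp
    have "h z = h (Re z *\<^sub>R 1 + Im z *\<^sub>R \<i>)"
      by (rule arg_cong[of _ _ h]) (simp add: complex_eq_iff)
    also have "\<dots> = Re z * h 1 + Im z * h \<i>"
      by (simp only: add scaleR real_scaleR_def)
    finally have "2 * complex_of_real (h z) = (z + cnj z) * h 1 + (- \<i>) * (z - cnj z) * h \<i>"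
      unfolding complex_add_cnj complex_diff_cnj by simp
    then have "2 * (z * complex_of_real (h z))
        = (z * z + z * cnj z) * h 1 + (- \<i>) * (z * z - z * cnj z) * h \<i>"
      by algebra
    then have "2 * (z * complex_of_real (h z)) = 2 * poly ?p z"
      unfolding zc by (simp add: algebra_simps)
    then show ?thesis
      by (simp only: power_one_right mult_cancel_left) simp
  qed
  then show ?case by blast
next
  case (const c)
  have "\<forall>z. cmod z = 1 \<longrightarrow> z ^ 0 * complex_of_real c = poly [:of_real c:] z" by simp
  then show ?case by blast
next
  case (add f g)
  then obtain m p n q where
    "\<And>z. cmod z = 1 \<Longrightarrow> z ^ m * of_real (f z) = poly p z"
    "\<And>z. cmod z = 1 \<Longrightarrow> z ^ n * of_real (g z) = poly q z" by blast
  then have "\<forall>z. cmod z = 1 \<longrightarrow>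
      z ^ (m + n) * of_real (f z + g z) = poly (p * monom 1 n + q * monom 1 m) z"
    by (simp add: poly_monom power_add algebra_simps)
  then show ?case by blast
next
  case (mult f g)
  then obtain m p n q where
    *: "\<And>z. cmod z = 1 \<Longrightarrow> z ^ m * of_real (f z) = poly p z"
    "\<And>z. cmod z = 1 \<Longrightarrow> z ^ n * of_real (g z) = poly q z" by blast
  have "\<forall>z. cmod z = 1 \<longrightarrow> z ^ (m + n) * of_real (f z * g z) = poly (p * q) z"
    by (simp add: *[symmetric] power_add algebra_simps)
  then show ?case by blast
qed

text \<open>Stone-Weierstrass gives a polynomial in \<open>Re z\<close> and \<open>Im z\<close>,
  which is a Laurent polynomial on the circle. The condition at 1 keeps the point (1, 0) off the
  zero set of \<open>z ^ m * w - poly p z\<close>; there the plurisubharmonic function will stay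
  finite.\<close>

lemma Laurent_polynomial_approximation:
  fixes f :: "complex \<Rightarrow> complex"
  assumes f: "continuous_on {z. cmod z = 1} f" and e: "0 < e"
  shows "\<exists>m p. poly p 1 \<noteq> 0 \<and> (\<forall>z. cmod z = 1 \<longrightarrow> cmod (f z - poly p z / z ^ m) < e)"
proof -
  have S: "compact {z::complex. cmod z = 1}"
    using compact_sphere[of "0::complex" 1] by (simp add: sphere_def)
  obtain g where g: "polynomial_function g"
      and fg: "\<And>z. cmod z = 1 \<Longrightarrow> cmod (f z - g z) < e / 2"
    using Stone_Weierstrass_polynomial_function[OF S f, of "e / 2"] e by auto
  have "real_polynomial_function (Re \<circ> g)" "real_polynomial_function (Im \<circ> g)"
    using g bounded_linear_Re bounded_linear_Im unfolding polynomial_function_def by blast+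
  then obtain m p n q where
    R: "\<And>z. cmod z = 1 \<Longrightarrow> z ^ m * of_real (Re (g z)) = poly p z" and
    I: "\<And>z. cmod z = 1 \<Longrightarrow> z ^ n * of_real (Im (g z)) = poly q z"
    using real_polynomial_function_on_circle[of "Re \<circ> g"]
      real_polynomial_function_on_circle[of "Im \<circ> g"] by auto
  define P where "P = p * monom 1 n + [:\<i>:] * q * monom 1 m"
  have P: "poly P z = z ^ (m + n) * g z" if "cmod z = 1" for z
  proof -
    have "poly P z = z ^ (m + n) * (of_real (Re (g z)) + \<i> * of_real (Im (g z)))"
      by (simp add: P_def poly_monom R[OF that, symmetric] I[OF that, symmetric] power_add algebra_simps)
    then show ?thesis by (simp only: complex_eq[symmetric])
  qed
  \<comment> \<open>A small constant \<open>d\<close>, added to the Laurent polynomial if needed,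
    moves its value at 1 away from 0 and uses up the other half of \<open>e\<close>.\<close>
  obtain d :: real where d: "\<bar>d\<bar> < e / 2" "poly P 1 + of_real d \<noteq> 0"
  proof (cases "poly P 1 = 0")
    case True
    show ?thesis by (rule that[of "e / 4"]) (use True e in auto)
  next
    case False
    show ?thesis by (rule that[of 0]) (use False e in auto)
  qed
  let ?P = "P + [:of_real d:] * monom 1 (m + n)"
  have "poly ?P 1 \<noteq> 0"
    using d by (simp add: poly_monom)
  moreover have "cmod (f z - poly ?P z / z ^ (m + n)) < e" if z: "cmod z = 1" for z
  proof -
    have "z \<noteq> 0" using z by auto
    then have "f z - poly ?P z / z ^ (m + n) = (f z - g z) - of_real d"
      by (simp add: P[OF z] poly_monom field_simps)
    also have "cmod \<dots> \<le> cmod (f z - g z) + \<bar>d\<bar>"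
      using norm_triangle_ineq4[of "f z - g z" "of_real d"] by simp
    finally show ?thesis using fg[OF z] d by linarith
  qed
  ultimately show ?thesis by blast
qed

text \<open>Since \<open>1 / z = cnj z\<close> on the circle, a negative power
  \<open>a / z ^ k\<close> has the same real part as \<open>cnj a * z ^ k\<close>. The induction
  peels off the most negative power.\<close>

lemma Re_Laurent_polynomial_on_circle:
  "\<exists>q. \<forall>z. cmod z = 1 \<longrightarrow> Re (poly p z / z ^ m) = Re (poly q z)"
proof (induction m arbitrary: p)
  case 0
  show ?case by auto
next
  case (Suc m)
  obtain a p' where p: "p = pCons a p'" by (cases p)
  obtain q where q: "\<And>z. cmod z = 1 \<Longrightarrow> Re (poly p' z / z ^ m) = Re (poly q z)"
    using Suc.IH by blast
  have "Re (poly p z / z ^ Suc m) = Re (poly (q + monom (cnj a) (Suc m)) z)" if z: "cmod z = 1" for z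
  proof -
    have "z \<noteq> 0" using z by auto
    then have "poly p z / z ^ Suc m = poly p' z / z ^ m + a * (inverse z) ^ Suc m"
      by (simp add: p field_simps)
    moreover have "inverse z = cnj z"
      using z complex_norm_square[of z] by (intro inverse_unique) simp
    moreover have "a * cnj z ^ Suc m = cnj (cnj a * z ^ Suc m)" by simp
    ultimately show ?thesis
      by (simp only: plus_complex.sel q[OF z] poly_add poly_monom cnj.sel)
  qed
  then show ?case by blast
qed

text \<open>Stands in for the Poisson integral: \<open>Re (poly q z)\<close> is harmonic on the
  whole plane and solves the Dirichlet problem up to the error \<open>e\<close>.\<close>

lemma harmonic_polynomial_approximation:
  fixes \<phi> :: "complex \<Rightarrow> real"
  assumes "continuous_on {z. cmod z = 1} \<phi>" and "0 < e"
  shows "\<exists>q. \<forall>z. cmod z = 1 \<longrightarrow> \<bar>\<phi> z - Re (poly q z)\<bar> < e"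
proof -
  have "continuous_on {z. cmod z = 1} (\<lambda>z. complex_of_real (\<phi> z))"
    by (intro continuous_intros assms)
  then obtain m p where
    mp: "\<And>z. cmod z = 1 \<Longrightarrow> cmod (of_real (\<phi> z) - poly p z / z ^ m) < e"
    using Laurent_polynomial_approximation assms(2) by blast
  obtain q where q: "\<And>z. cmod z = 1 \<Longrightarrow> Re (poly p z / z ^ m) = Re (poly q z)"
    using Re_Laurent_polynomial_on_circle by blast
  have "\<bar>\<phi> z - Re (poly q z)\<bar> < e" if "cmod z = 1" for z
    using mp[OF that] abs_Re_le_cmod[of "of_real (\<phi> z) - poly p z / z ^ m"] q[OF that] by simp
  then show ?thesis by blast
qed

section \<open>Mean values over circles\<close>

text \<open>Every nonconstant monomial has a primitive of period \<open>2 * pi\<close> along the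
  circle, so only the constant coefficient contributes.\<close>

lemma has_integral_poly_circle:
  "((\<lambda>t. poly q (cis t)) has_integral of_real (2 * pi) * poly q 0) {0..2 * pi}"
proof -
  have "((\<lambda>t. coeff q i * cis t ^ i) has_integral (if i = 0 then of_real (2 * pi) * coeff q 0 else 0))
      {0..2 * pi}" for i
  proof (cases "i = 0")
    case True
    then show ?thesis
      using has_integral_const_real[of "coeff q 0" 0 "2 * pi"]
      by (simp add: scaleR_conv_of_real)
  next
    case False
    let ?F = "\<lambda>t. coeff q i * exp (\<i> * of_nat i * of_real t) / (\<i> * of_nat i)"
    have "((\<lambda>t. coeff q i * cis t ^ i) has_integral (?F (2 * pi) - ?F 0)) {0..2 * pi}"
    proof (rule fundamental_theorem_of_calculus)
      fix t
      have "((\<lambda>z. coeff q i * exp (\<i> * of_nat i * z) / (\<i> * of_nat i)) has_field_derivative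
          coeff q i * cis t ^ i) (at (of_real t))"
        using False
        by (auto intro!: derivative_eq_intros simp: cis_conv_exp exp_of_nat_mult[symmetric] mult_ac)
      then show "(?F has_vector_derivative coeff q i * cis t ^ i) (at t within {0..2 * pi})"
        by (rule has_vector_derivative_real_field)
    qed simp
    moreover have "exp (\<i> * of_nat i * of_real (2 * pi)) = 1"
      using exp_two_pi_i exp_of_nat_mult[of i "2 * of_real pi * \<i>"] by (simp add: mult_ac)
    ultimately show ?thesis using False by simp
  qed
  then have "((\<lambda>t. \<Sum>i\<le>degree q. coeff q i * cis t ^ i) has_integral
      (\<Sum>i\<le>degree q. if i = 0 then of_real (2 * pi) * coeff q 0 else 0)) {0..2 * pi}"
    by (intro has_integral_sum) auto
  then show ?thesis
    by (simp add: poly_altdef poly_0_coeff_0)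
qed

text \<open>Truncation at \<eta> keeps the logarithm continuous across the zeros of
  \<open>F\<close>. Other circles come from an affine change of variable in
  \<open>F\<close>.\<close>

lemma sub_mean_ln_max:
  assumes F: "F holomorphic_on UNIV" and \<eta>: "0 < \<eta>"
  shows "2 * pi * ln (max (cmod (F 0)) \<eta>) \<le> integral {0..2 * pi} (\<lambda>t. ln (max (cmod (F (cis t))) \<eta>))"
proof -
  define \<phi> where "\<phi> z = ln (max (cmod (F z)) \<eta>)" for z
  have contF: "continuous_on A F" for A
    using F holomorphic_on_imp_continuous_on continuous_on_subset by blast
  have cont: "continuous_on A \<phi>" for A
    unfolding \<phi>_def using \<eta> by (intro continuous_intros contF) (auto simp: max_def)
  have cont': "continuous_on A (\<lambda>t. \<phi> (cis t))" for A
    by (rule continuous_on_compose2[OF cont[of UNIV]]) (auto intro: continuous_intros)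
  have int: "(\<lambda>t. \<phi> (cis t)) integrable_on {0..2 * pi}"
    by (rule integrable_continuous_real[OF cont'])
  have exp_\<phi>: "exp (\<phi> z) = max (cmod (F z)) \<eta>" for z
    using \<eta> by (simp add: \<phi>_def less_max_iff_disj)
  txt \<open>Where \<open>\<bar>F 0\<bar> > \<eta>\<close>, compare with a harmonic polynomial \<open>Re q \<ge> \<phi>\<close> on the circle: the
    maximum principle for \<open>F exp (- q)\<close> gives \<open>ln \<bar>F 0\<bar> \<le> Re (q 0)\<close>, without any zero counting.\<close>
  show ?thesis
  proof (cases "cmod (F 0) \<le> \<eta>")
    case True
    \<comment> \<open>Here the value at the centre is the minimal possible one,
      \<open>ln \<eta>\<close>.\<close>
    have "integral {0..2 * pi} (\<lambda>t. ln \<eta>) \<le> integral {0..2 * pi} (\<lambda>t. \<phi> (cis t))"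
      using \<eta> by (intro integral_le int) (auto simp: \<phi>_def)
    with True show ?thesis
      by (simp add: \<phi>_def max_absorb2)
  next
    case False
    have "2 * pi * \<phi> 0 \<le> integral {0..2 * pi} (\<lambda>t. \<phi> (cis t)) + e" if e: "0 < e" for e
    proof -
      \<comment> \<open>Approximating \<phi> + d to within d places \<open>Re (poly q z)\<close>
        between \<phi> and \<phi> + 2 d on the circle. The excess 2 d, integrated over the circle,
        is exactly \<open>e\<close>.\<close>
      define d where "d = e / (4 * pi)"
      have "0 < d" using e by (simp add: d_def)
      moreover have "continuous_on {z. cmod z = 1} (\<lambda>z. \<phi> z + d)"
        by (intro continuous_intros cont)
      ultimately obtain q where q: "\<And>z. cmod z = 1 \<Longrightarrow> \<bar>\<phi> z + d - Re (poly q z)\<bar> < d"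
        using harmonic_polynomial_approximation[of "\<lambda>z. \<phi> z + d" d] by blast
      have "cmod (F 0 * exp (- poly q 0)) \<le> 1"
      proof (rule maximum_modulus_frontier[where S = "cball 0 1" and \<xi> = 0 and
            f = "\<lambda>z. F z * exp (- poly q z)"])
        fix z :: complex
        assume "z \<in> frontier (cball 0 1)"
        then have "cmod z = 1" by simp
        then have "\<phi> z \<le> Re (poly q z)" using q[of z] by linarith
        then have "max (cmod (F z)) \<eta> \<le> exp (Re (poly q z))"
          unfolding exp_\<phi>[symmetric] by simp
        then show "cmod (F z * exp (- poly q z)) \<le> 1"
          by (simp add: norm_mult norm_divide exp_minus divide_simps)
      next
        show "(\<lambda>z. F z * exp (- poly q z)) holomorphic_on interior (cball 0 1)"
          by (intro holomorphic_intros holomorphic_on_subset[OF F]) auto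
        show "continuous_on (closure (cball 0 1)) (\<lambda>z. F z * exp (- poly q z))"
          by (intro continuous_intros contF)
      qed auto
      then have "cmod (F 0) \<le> exp (Re (poly q 0))"
        by (simp add: norm_mult norm_divide exp_minus divide_simps)
      then have "\<phi> 0 \<le> Re (poly q 0)"
        using False exp_\<phi>[of 0] by (metis exp_le_cancel_iff max.absorb1 nle_le)
      moreover have Re_int: "((\<lambda>t. Re (poly q (cis t))) has_integral 2 * pi * Re (poly q 0)) {0..2 * pi}"
        using has_integral_Re[OF has_integral_poly_circle[of q]] by simp
      moreover have "integral {0..2 * pi} (\<lambda>t. Re (poly q (cis t)))
          \<le> integral {0..2 * pi} (\<lambda>t. \<phi> (cis t) + 2 * d)"
      proof (rule integral_le)
        show "Re (poly q (cis t)) \<le> \<phi> (cis t) + 2 * d" for t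
          using q[of "cis t"] by simp
      qed (use Re_int int in \<open>auto intro: integrable_add\<close>)
      moreover have "integral {0..2 * pi} (\<lambda>t. \<phi> (cis t) + 2 * d)
          = integral {0..2 * pi} (\<lambda>t. \<phi> (cis t)) + e"
        using int by (subst Henstock_Kurzweil_Integration.integral_add) (auto simp: d_def)
      moreover have "integral {0..2 * pi} (\<lambda>t. Re (poly q (cis t))) = 2 * pi * Re (poly q 0)"
        using Re_int by (rule integral_unique)
      moreover have "2 * pi * \<phi> 0 \<le> 2 * pi * Re (poly q 0)"
        using \<open>\<phi> 0 \<le> Re (poly q 0)\<close> by simp
      ultimately show ?thesis by linarith
    qed
    then show ?thesis
      unfolding \<phi>_def[symmetric] by (rule field_le_epsilon)
  qed
qed

section \<open>Continuous plurisubharmonic functions and their decreasing limits\<close>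

text \<open>The radius of the circle is absorbed into \<open>b\<close>.\<close>

definition continuous_psh :: "(complex ^ 'n \<Rightarrow> real) \<Rightarrow> bool" where
  "continuous_psh h \<longleftrightarrow> continuous_on UNIV h \<and>
     (\<forall>a b. 2 * pi * h a \<le> integral {0..2 * pi} (\<lambda>t. h (a + cis t *s b)))"

lemma continuous_on_vector_scalar_mult [continuous_intros]:
  fixes b :: "complex ^ 'n"
  assumes "continuous_on A f"
  shows "continuous_on A (\<lambda>x. f x *s b)"
  unfolding vector_scalar_mult_def by (intro continuous_intros assms)

lemma continuous_on_circle:
  fixes h :: "complex ^ 'n \<Rightarrow> real"
  assumes "continuous_on UNIV h"
  shows "continuous_on A (\<lambda>t. h (a + cis t *s b))"
  by (rule continuous_on_compose2[OF assms]) (auto intro!: continuous_intros)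

lemma continuous_psh_sum:
  assumes "\<And>k. k \<in> I \<Longrightarrow> continuous_psh (h k)"
  shows "continuous_psh (\<lambda>x. \<Sum>k\<in>I. h k x)"
proof -
  have c: "continuous_on UNIV (h k)" if "k \<in> I" for k
    using assms[OF that] by (simp add: continuous_psh_def)
  have "2 * pi * (\<Sum>k\<in>I. h k a) \<le> integral {0..2 * pi} (\<lambda>t. \<Sum>k\<in>I. h k (a + cis t *s b))" for a b
  proof (cases "finite I")
    case True
    have "2 * pi * (\<Sum>k\<in>I. h k a) = (\<Sum>k\<in>I. 2 * pi * h k a)"
      by (simp add: sum_distrib_left)
    also have "\<dots> \<le> (\<Sum>k\<in>I. integral {0..2 * pi} (\<lambda>t. h k (a + cis t *s b)))"
      using assms by (intro sum_mono) (simp add: continuous_psh_def)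
    also have "\<dots> = integral {0..2 * pi} (\<lambda>t. \<Sum>k\<in>I. h k (a + cis t *s b))"
      using True c
      by (intro integral_sum[symmetric] integrable_continuous_real continuous_on_circle) auto
    finally show ?thesis .
  qed simp
  then show ?thesis
    unfolding continuous_psh_def using c by (auto intro!: continuous_intros)
qed

text \<open>On each ball the sequence decreases from some index on, so there the
  \<open>liminf\<close> is both the limit and the infimum of a tail. Upper semicontinuity follows
  because an infimum of continuous functions has it, and the sub-mean inequality because the circle
  means converge. The index may depend on the ball, as happens for partial sums whose k-th term is
  nonpositive only on the ball of radius k.\<close>

lemma continuous_psh_decreasing_limit:
  fixes s :: "nat \<Rightarrow> complex ^ 'n \<Rightarrow> real"
  assumes psh: "\<And>n. continuous_psh (s n)"
    and dec: "\<And>R. \<exists>N. \<forall>n\<ge>N. \<forall>x. norm x \<le> R \<longrightarrow> s (Suc n) x \<le> s n x"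
  shows "plurisubharmonic (\<lambda>x. liminf (\<lambda>n. ereal (s n x)))" (is "plurisubharmonic ?u")
proof -
  have cont: "continuous_on UNIV (s n)" for n
    using psh by (simp add: continuous_psh_def)
  have ball: "\<exists>N. \<forall>x. norm x \<le> R \<longrightarrow> antimono (\<lambda>n. s (N + n) x) \<and>
      (\<lambda>n. ereal (s (N + n) x)) \<longlonglongrightarrow> ?u x \<and> (\<forall>n\<ge>N. ?u x \<le> s n x)" for R
  proof -
    obtain N where N: "\<And>n x. n \<ge> N \<Longrightarrow> norm x \<le> R \<Longrightarrow> s (Suc n) x \<le> s n x"
      using dec by blast
    have "antimono (\<lambda>n. s (N + n) x) \<and>
      (\<lambda>n. ereal (s (N + n) x)) \<longlonglongrightarrow> ?u x \<and> (\<forall>n\<ge>N. ?u x \<le> s n x)" if x: "norm x \<le> R" for x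
    proof -
      have anti: "antimono (\<lambda>n. s (N + n) x)"
        unfolding decseq_Suc_iff using N x by simp
      then have "decseq (\<lambda>n. ereal (s (N + n) x))"
        by (simp add: antimono_def)
      then have lim: "(\<lambda>n. ereal (s (N + n) x)) \<longlonglongrightarrow> (INF n. ereal (s (N + n) x))"
        by (rule LIMSEQ_INF)
      then have "(\<lambda>n. ereal (s n x)) \<longlonglongrightarrow> (INF n. ereal (s (N + n) x))"
        using LIMSEQ_offset[of "\<lambda>n. ereal (s n x)" N] by (simp add: add.commute)
      then have u: "?u x = (INF n. ereal (s (N + n) x))"
        by (intro lim_imp_Liminf) auto
      have "?u x \<le> s n x" if "n \<ge> N" for n
        unfolding u using that by (intro INF_lower2[of "n - N"]) auto
      with anti lim u show ?thesis by simp
    qed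
    then show ?thesis by blast
  qed
  have usc: "open {x. ?u x < c}" for c
  proof (subst open_subopen, safe)
    fix x assume x: "?u x < c"
    obtain N where N: "\<And>y. norm y \<le> norm x + 1 \<Longrightarrow>
        (\<lambda>n. ereal (s (N + n) y)) \<longlonglongrightarrow> ?u y \<and> (\<forall>n\<ge>N. ?u y \<le> s n y)"
      using ball by blast
    have "\<forall>\<^sub>F n in sequentially. ereal (s (N + n) x) < c"
      using N[of x] x by (intro order_tendstoD(2)) auto
    then obtain n where n: "ereal (s (N + n) x) < c"
      using eventually_happens by force
    let ?T = "ball x 1 \<inter> {y. ereal (s (N + n) y) < c}"
    have "open {y. ereal (s (N + n) y) < c}"
      by (intro open_Collect_less continuous_intros cont)
    then have "open ?T" by auto
    moreover have "x \<in> ?T" using n by simp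
    moreover have "?T \<subseteq> {x. ?u x < c}"
    proof safe
      fix y assume y: "y \<in> ball x 1" "ereal (s (N + n) y) < c"
      have "norm y \<le> norm x + 1"
        using y(1) norm_triangle_ineq2[of y x] by (simp add: dist_norm norm_minus_commute)
      then have "?u y \<le> s (N + n) y" using N le_add1 by blast
      then show "?u y < c" using y(2) by simp
    qed
    ultimately show "\<exists>T. open T \<and> x \<in> T \<and> T \<subseteq> {x. ?u x < c}" by blast
  qed
  have fin: "?u x < \<infinity>" for x
  proof -
    obtain N where "?u x \<le> ereal (s N x)"
      using ball[of "norm x"] by blast
    also have "\<dots> < \<infinity>" by simp
    finally show ?thesis .
  qed
  have mean: "?u (a + \<zeta> *s b) \<le> circle_mean (\<lambda>\<zeta>. ?u (a + \<zeta> *s b)) \<zeta> r" if r: "0 < r" for a b \<zeta> r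
  proof -
    define a' where "a' = a + \<zeta> *s b"
    define b' where "b' = of_real r *s b"
    have pt: "a + (\<zeta> + of_real r * cis t) *s b = a' + cis t *s b'" for t
      by (simp add: a'_def b'_def vec_eq_iff algebra_simps)
    \<comment> \<open>The circle and its centre lie in one ball, so a single \<open>N\<close> serves
      all their points.\<close>
    have "compact ((\<lambda>t. a' + cis t *s b') ` {0..2 * pi})"
      by (intro compact_continuous_image continuous_intros) auto
    then have "bounded ((\<lambda>t. a' + cis t *s b') ` {0..2 * pi} \<union> {a'})"
      by (simp add: compact_imp_bounded)
    then obtain R where R: "\<And>x. x \<in> (\<lambda>t. a' + cis t *s b') ` {0..2 * pi} \<union> {a'} \<Longrightarrow> norm x \<le> R"
      unfolding bounded_iff by blast
    obtain N where N: "\<And>y. norm y \<le> R \<Longrightarrow> antimono (\<lambda>n. s (N + n) y) \<and>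
        (\<lambda>n. ereal (s (N + n) y)) \<longlonglongrightarrow> ?u y \<and> (\<forall>n\<ge>N. ?u y \<le> s n y)"
      using ball by blast
    define \<psi> where "\<psi> n t = s (N + n) (a' + cis t *s b')" for n t
    define U where "U t = ?u (a' + cis t *s b')" for t
    have meas: "\<psi> n \<in> borel_measurable borel" for n
      unfolding \<psi>_def by (intro borel_measurable_continuous_onI continuous_on_circle cont)
    have U: "(\<lambda>n. ereal (\<psi> n t)) \<longlonglongrightarrow> U t" "antimono (\<lambda>n. \<psi> n t)" if "t \<in> {0..2 * pi}" for t
      using N R that unfolding \<psi>_def U_def by blast+
    have measU: "U \<in> borel_measurable borel"
      unfolding U_def \<psi>_def
      by (intro borel_measurable_liminf borel_measurable_ereal borel_measurable_continuous_onI
          continuous_on_circle cont)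
    let ?I = "\<lambda>t. indicator {0..2 * pi} t :: ennreal"
    have fin0: "(\<integral>\<^sup>+t\<in>{0..2 * pi}. e2ennreal (ereal (\<psi> 0 t)) \<partial>lborel) < \<infinity>"
    proof -
      have "integrable lborel (\<lambda>t. indicator {0..2 * pi} t *\<^sub>R \<psi> 0 t)"
        using borel_integrable_atLeastAtMost'[of 0 "2 * pi" "\<psi> 0"]
        unfolding \<psi>_def set_integrable_def by (auto intro!: continuous_on_circle cont)
      then have "(\<integral>\<^sup>+t. ennreal (indicator {0..2 * pi} t *\<^sub>R \<psi> 0 t) \<partial>lborel) < \<infinity>"
        by (auto simp: real_integrable_def less_top[symmetric])
      also have "(\<integral>\<^sup>+t. ennreal (indicator {0..2 * pi} t *\<^sub>R \<psi> 0 t) \<partial>lborel)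
          = (\<integral>\<^sup>+t\<in>{0..2 * pi}. e2ennreal (ereal (\<psi> 0 t)) \<partial>lborel)"
        by (intro nn_integral_cong) (simp add: e2ennreal_ereal split: split_indicator)
      finally show ?thesis .
    qed
    \<comment> \<open>The positive parts decrease and are dominated by the first one, whose integral
      is finite.\<close>
    have pos: "(\<lambda>n. \<integral>\<^sup>+t\<in>{0..2 * pi}. e2ennreal (ereal (\<psi> n t)) \<partial>lborel)
        \<longlonglongrightarrow> (\<integral>\<^sup>+t\<in>{0..2 * pi}. e2ennreal (U t) \<partial>lborel)"
    proof (rule nn_integral_dominated_convergence)
      show "AE t in lborel. e2ennreal (ereal (\<psi> n t)) * ?I t \<le> e2ennreal (ereal (\<psi> 0 t)) * ?I t" for n
        using U(2)
        by (intro AE_I2) (auto split: split_indicator intro!: ennreal_leI simp: antimono_def)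
      show "AE t in lborel. (\<lambda>n. e2ennreal (ereal (\<psi> n t)) * ?I t) \<longlonglongrightarrow> e2ennreal (U t) * ?I t"
        using U(1) by (intro AE_I2)
          (auto split: split_indicator simp del: e2ennreal_ereal intro!: tendsto_e2ennrealI)
      show "(\<integral>\<^sup>+t\<in>{0..2 * pi}. e2ennreal (ereal (\<psi> 0 t)) \<partial>lborel) < \<infinity>"
        by (rule fin0)
    qed (use meas measU in \<open>auto simp: e2ennreal_ereal\<close>)
    \<comment> \<open>The negative parts increase, so monotone convergence applies even if the limit
      is infinite.\<close>
    have neg: "(\<lambda>n. \<integral>\<^sup>+t\<in>{0..2 * pi}. e2ennreal (- ereal (\<psi> n t)) \<partial>lborel)
        \<longlonglongrightarrow> (\<integral>\<^sup>+t\<in>{0..2 * pi}. e2ennreal (- U t) \<partial>lborel)"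
    proof (rule nn_integral_LIMSEQ)
      show "incseq (\<lambda>n t. e2ennreal (- ereal (\<psi> n t)) * ?I t)"
        using U(2)
        by (auto simp: incseq_def le_fun_def antimono_def split: split_indicator intro!: ennreal_leI)
      show "(\<lambda>n. e2ennreal (- ereal (\<psi> n t)) * ?I t) \<longlonglongrightarrow> e2ennreal (- U t) * ?I t" for t
        using U(1)
        by (auto split: split_indicator simp del: e2ennreal_ereal uminus_ereal.simps
            intro!: tendsto_e2ennrealI tendsto_uminus_ereal)
    qed (use meas in auto)
    \<comment> \<open>Excludes the form \<infinity> - \<infinity> when the two limits are
      subtracted.\<close>
    have finP: "(\<integral>\<^sup>+t\<in>{0..2 * pi}. e2ennreal (U t) \<partial>lborel) \<noteq> \<infinity>"
    proof -
      have "U t \<le> ereal (\<psi> 0 t)" if "t \<in> {0..2 * pi}" for t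
        using N R that le_add1[of N 0] unfolding U_def \<psi>_def by blast
      then have "(\<integral>\<^sup>+t\<in>{0..2 * pi}. e2ennreal (U t) \<partial>lborel)
          \<le> (\<integral>\<^sup>+t\<in>{0..2 * pi}. e2ennreal (ereal (\<psi> 0 t)) \<partial>lborel)"
        by (intro nn_integral_mono) (auto split: split_indicator simp del: e2ennreal_ereal intro!: e2ennreal_mono)
      with fin0 show ?thesis by (metis leD infinity_ennreal_def)
    qed
    have lim: "(\<lambda>n. circle_mean (\<lambda>\<zeta>. ereal (s (N + n) (a + \<zeta> *s b))) \<zeta> r)
        \<longlonglongrightarrow> circle_mean (\<lambda>\<zeta>. ?u (a + \<zeta> *s b)) \<zeta> r"
      unfolding circle_mean_def pt \<psi>_def[symmetric] U_def[symmetric]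
      using finP
      by (intro tendsto_divide_ereal tendsto_diff_ereal_general tendsto_enn2erealI pos neg tendsto_const) auto
    have "?u a' \<le> circle_mean (\<lambda>\<zeta>. ereal (s (N + n) (a + \<zeta> *s b))) \<zeta> r" for n
    proof -
      have si: "set_integrable lborel {0..2 * pi} (\<lambda>t. s (N + n) (a + (\<zeta> + of_real r * cis t) *s b))"
        unfolding pt by (intro borel_integrable_atLeastAtMost' continuous_on_circle cont)
      have "?u a' \<le> ereal (s (N + n) a')"
        using N R le_add1 by blast
      also have "s (N + n) a' \<le> integral {0..2 * pi} (\<lambda>t. s (N + n) (a' + cis t *s b')) / (2 * pi)"
        using psh[of "N + n"] by (simp add: continuous_psh_def field_simps)
      also have "ereal \<dots> = circle_mean (\<lambda>\<zeta>. ereal (s (N + n) (a + \<zeta> *s b))) \<zeta> r"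
        using circle_mean_real[of "\<lambda>\<zeta>. s (N + n) (a + \<zeta> *s b)", OF si]
        by (simp only: set_borel_integral_eq_integral(2)[OF si[unfolded pt]] pt)
      finally show ?thesis by simp
    qed
    then show ?thesis
      using LIMSEQ_le_const[OF lim] unfolding a'_def by blast
  qed
  have fin_line: "open {\<zeta>. ?u (a + \<zeta> *s b) < c}" for a b c
  proof -
    have "continuous_on UNIV (\<lambda>\<zeta>. a + \<zeta> *s b)"
      by (intro continuous_intros)
    from open_vimage[OF usc[of c] this] show ?thesis
      by (simp only: vimage_def mem_Collect_eq)
  qed
  show ?thesis
    unfolding plurisubharmonic_def subharmonic_def upper_semicontinuous_def
    using usc fin mean fin_line by auto
qed

section \<open>Building functions that equal -\<infinity> on a given set\<close>

text \<open>Take \<open>h = c * (ln (max (cmod (F x)) \<epsilon>) - A)\<close>. First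
  \<open>A\<close> bounds \<open>ln (cmod (F x))\<close> on the ball, then \<open>c\<close> is
  chosen small enough for the value at \<open>x0\<close>, and only then the truncation level
  \<epsilon>: truncation can only raise the value at \<open>x0\<close>, so it does not spoil that
  bound.\<close>

lemma continuous_psh_near_zero_set:
  fixes F :: "complex ^ 'n \<Rightarrow> complex"
  assumes cont: "continuous_on UNIV F"
    and hol: "\<And>a b. (\<lambda>\<zeta>. F (a + \<zeta> *s b)) holomorphic_on UNIV"
    and x0: "F x0 \<noteq> 0" and \<delta>: "0 < \<delta>"
  shows "\<exists>\<epsilon>>0. \<exists>h. continuous_psh h \<and> (\<forall>x. norm x \<le> R \<longrightarrow> h x \<le> 0) \<and> - \<delta> \<le> h x0 \<and>
           (\<forall>x. cmod (F x) \<le> \<epsilon> \<longrightarrow> h x \<le> -1)"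
proof -
  have "compact (F ` cball 0 R)"
    by (intro compact_continuous_image continuous_on_subset[OF cont]) auto
  then have "bounded (F ` cball 0 R)"
    by (rule compact_imp_bounded)
  then obtain B where B: "\<And>x. norm x \<le> R \<Longrightarrow> cmod (F x) \<le> B"
    unfolding bounded_iff by force
  define A where "A = ln (max B 1)"
  have "0 \<le> A" by (simp add: A_def)
  have B_le: "B \<le> exp A" by (simp add: A_def)
  \<comment> \<open>\<open>D\<close> bounds the drop from \<open>A\<close> down to
    \<open>ln (cmod (F x0))\<close>; the summand 1 makes it positive, so that
    \<open>c * D = \<delta>\<close> can be solved for \<open>c\<close>.\<close>
  define D where "D = \<bar>ln (cmod (F x0))\<bar> + A + 1"
  have "0 < D" using \<open>0 \<le> A\<close> by (simp add: D_def)
  define c where "c = \<delta> / D"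
  have c: "0 < c" using \<delta> \<open>0 < D\<close> by (simp add: c_def)
  txt \<open>This value of \<open>\<epsilon>\<close> makes \<open>h = -1\<close> where \<open>\<bar>F\<bar> \<le> \<epsilon>\<close>.\<close>
  define \<epsilon> where "\<epsilon> = exp (A - 1 / c)"
  \<comment> \<open>With \<epsilon> at most \<open>exp A\<close>, truncation preserves
    \<open>h x \<le> 0\<close> on the ball.\<close>
  have \<epsilon>: "0 < \<epsilon>" "\<epsilon> \<le> exp A" using c by (simp_all add: \<epsilon>_def)
  define h where "h x = c * (ln (max (cmod (F x)) \<epsilon>) - A)" for x
  have "continuous_psh h"
    unfolding continuous_psh_def
  proof (intro conjI allI)
    show "continuous_on UNIV h"
      unfolding h_def using \<epsilon> by (intro continuous_intros cont) (auto simp: max_def)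
    fix a b :: "complex ^ 'n"
    let ?g = "\<lambda>t. ln (max (cmod (F (a + cis t *s b))) \<epsilon>)"
    have "continuous_on UNIV (\<lambda>x. ln (max (cmod (F x)) \<epsilon>))"
      using \<epsilon> by (intro continuous_intros cont) (auto simp: max_def)
    then have int: "?g integrable_on {0..2 * pi}"
      by (intro integrable_continuous_real continuous_on_circle)
    have "integral {0..2 * pi} (\<lambda>t. ?g t - A) = integral {0..2 * pi} ?g - 2 * pi * A"
      using Henstock_Kurzweil_Integration.integral_diff[OF int integrable_const_ivl[of A]] by simp
    then have "integral {0..2 * pi} (\<lambda>t. h (a + cis t *s b)) = c * (integral {0..2 * pi} ?g - 2 * pi * A)"
      by (simp add: h_def)
    moreover have "2 * pi * ln (max (cmod (F a)) \<epsilon>) \<le> integral {0..2 * pi} ?g"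
      using sub_mean_ln_max[OF hol[of a b] \<epsilon>(1)] by simp
    then have "c * (2 * pi * ln (max (cmod (F a)) \<epsilon>) - 2 * pi * A) \<le> c * (integral {0..2 * pi} ?g - 2 * pi * A)"
      using c by simp
    ultimately show "2 * pi * h a \<le> integral {0..2 * pi} (\<lambda>t. h (a + cis t *s b))"
      by (simp add: h_def algebra_simps)
  qed
  moreover have "h x \<le> 0" if "norm x \<le> R" for x
  proof -
    have "max (cmod (F x)) \<epsilon> \<le> exp A"
      using B[OF that] B_le \<epsilon> by simp
    then have "ln (max (cmod (F x)) \<epsilon>) \<le> A"
      using \<epsilon> by (subst ln_exp[of A, symmetric], subst ln_le_cancel_iff) (auto simp: less_max_iff_disj)
    then show ?thesis using c by (simp add: h_def mult_le_0_iff)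
  qed
  moreover have "- \<delta> \<le> h x0"
  proof -
    have "ln (cmod (F x0)) \<le> ln (max (cmod (F x0)) \<epsilon>)"
      using x0 by (intro iffD2[OF ln_le_cancel_iff]) (auto simp: less_max_iff_disj)
    then have "- D \<le> ln (max (cmod (F x0)) \<epsilon>) - A"
      unfolding D_def by linarith
    then have "c * - D \<le> h x0"
      unfolding h_def using c by (intro mult_left_mono) auto
    moreover have "c * - D = - \<delta>"
      using \<open>0 < D\<close> by (simp add: c_def)
    ultimately show ?thesis by simp
  qed
  moreover have "h x \<le> -1" if "cmod (F x) \<le> \<epsilon>" for x
    using that c by (simp add: h_def max_absorb2 \<epsilon>_def)
  ultimately show ?thesis using \<epsilon>(1) by blast
qed

text \<open>The sum of all \<open>h k\<close> works. On a fixed ball all but finitely many terms are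
  nonpositive, so the partial sums eventually decrease; at \<open>x0\<close> they stay above minus a
  geometric series, while on \<open>K\<close> each term costs at least 1.\<close>

lemma pluripolar_criterion:
  fixes h :: "nat \<Rightarrow> complex ^ 'n \<Rightarrow> real"
  assumes psh: "\<And>k. continuous_psh (h k)"
    and le_0: "\<And>k x. norm x \<le> real k \<Longrightarrow> h k x \<le> 0"
    and x0: "\<And>k. - ((1 / 2) ^ k) \<le> h k x0"
    and K: "\<And>k x. x \<in> K \<Longrightarrow> h k x \<le> -1"
  shows "pluripolar K"
proof -
  define s where "s n x = (\<Sum>k<n. h k x)" for n x
  let ?u = "\<lambda>x. liminf (\<lambda>n. ereal (s n x))"
  have "plurisubharmonic ?u"
  proof (rule continuous_psh_decreasing_limit)
    show "continuous_psh (s n)" for n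
      unfolding s_def by (intro continuous_psh_sum psh)
    show "\<exists>N. \<forall>n\<ge>N. \<forall>x. norm x \<le> R \<longrightarrow> s (Suc n) x \<le> s n x" for R
    proof -
      obtain N where "R \<le> real N" using real_arch_simple by blast
      then have "\<forall>n\<ge>N. \<forall>x. norm x \<le> R \<longrightarrow> s (Suc n) x \<le> s n x"
        using le_0 by (fastforce simp: s_def)
      then show ?thesis by blast
    qed
  qed
  moreover have "?u x0 \<noteq> -\<infinity>"
  proof -
    have "- 2 \<le> s n x0" for n
    proof -
      have "(\<Sum>k<n. (1 / 2 :: real) ^ k) \<le> 2"
        by (simp add: sum_gp_strict)
      moreover have "(\<Sum>k<n. - ((1 / 2 :: real) ^ k)) \<le> s n x0"
        unfolding s_def by (intro sum_mono x0)
      ultimately show ?thesis by (simp add: sum_negf)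
    qed
    then have "ereal (-2) \<le> ?u x0"
      by (intro Liminf_bounded always_eventually) (metis ereal_less_eq(3))
    then show ?thesis by auto
  qed
  moreover have "?u x = -\<infinity>" if "x \<in> K" for x
  proof -
    have "s n x \<le> - real n" for n
      using sum_mono[of "{..<n}" "\<lambda>k. h k x" "\<lambda>k. -1"] K[OF that] by (simp add: s_def)
    then have "\<exists>N. \<forall>n\<ge>N. ereal (s n x) \<le> ereal B" for B
      using real_arch_simple[of "- B"] by (metis ereal_less_eq(3) le_minus_iff minus_le_iff of_nat_mono order_trans)
    then have "(\<lambda>n. ereal (s n x)) \<longlonglongrightarrow> -\<infinity>"
      unfolding Lim_MInfty by blast
    then show ?thesis by (intro lim_imp_Liminf) auto
  qed
  ultimately show ?thesis unfolding pluripolar_def by blast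
qed

text \<open>The Baire category theorem for the space of continuous functions on \<open>S\<close>.\<close>

lemma nested_uniform_approximation:
  fixes P :: "nat \<Rightarrow> ('a::topological_space \<Rightarrow> 'b::banach) \<Rightarrow> bool"
  assumes step: "\<And>k g r. continuous_on S g \<Longrightarrow> 0 < r \<Longrightarrow>
      \<exists>g' r'. continuous_on S g' \<and> 0 < r' \<and> (\<forall>z\<in>S. norm (g' z - g z) \<le> r) \<and>
        (\<forall>x. (\<forall>z\<in>S. norm (x z - g' z) \<le> r') \<longrightarrow> P k x)"
  shows "\<exists>x. continuous_on S x \<and> (\<forall>k. P k x)"
proof -
  define I where "I (a :: ('a \<Rightarrow> 'b) \<times> real) \<longleftrightarrow> continuous_on S (fst a) \<and> 0 < snd a" for a
  \<comment> \<open>A pair is a closed ball in the sup norm, given by centre and radius. Centres at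
    distance at most the difference of the radii make the new ball part of the old one, and halving
    shrinks the radii to 0.\<close>
  define Q where "Q k a b \<longleftrightarrow> snd b \<le> snd a / 2 \<and>
      (\<forall>z\<in>S. norm (fst b z - fst a z) \<le> snd a - snd b) \<and>
      (\<forall>x. (\<forall>z\<in>S. norm (x z - fst b z) \<le> snd b) \<longrightarrow> P k x)" for k and a b :: "('a \<Rightarrow> 'b) \<times> real"
  have "\<exists>f. \<forall>n. I (f n) \<and> Q n (f n) (f (Suc n))"
  proof (rule dependent_nat_choice)
    show "\<exists>a. I a"
      by (rule exI[of _ "(\<lambda>_. 0, 1)"]) (simp add: I_def)
    fix a k assume "I a"
    then have "continuous_on S (fst a)" "0 < snd a / 2" by (auto simp: I_def)
    from step[OF this, of k] obtain g' r' where g: "continuous_on S g'" "0 < r'"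
        "\<And>z. z \<in> S \<Longrightarrow> norm (g' z - fst a z) \<le> snd a / 2"
        and P: "\<forall>x. (\<forall>z\<in>S. norm (x z - g' z) \<le> r') \<longrightarrow> P k x"
      by blast
    \<comment> \<open>The centre moved by at most half the old radius, so capping the new radius at
      the other half keeps the balls nested.\<close>
    let ?b = "(g', min r' (snd a / 2))"
    have "norm (g' z - fst a z) \<le> snd a - min r' (snd a / 2)" if "z \<in> S" for z
      using g(3)[OF that] by linarith
    moreover have "P k x" if "\<forall>z\<in>S. norm (x z - g' z) \<le> min r' (snd a / 2)" for x
      using P that by simp
    ultimately have "Q k a ?b"
      by (simp add: Q_def)
    moreover have "I ?b"
      using g \<open>0 < snd a / 2\<close> by (simp add: I_def)
    ultimately show "\<exists>b. I b \<and> Q k a b" by blast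
  qed
  then obtain f where f: "\<And>n. I (f n)" "\<And>n. Q n (f n) (f (Suc n))" by blast
  define g where "g n = fst (f n)" for n
  define r where "r n = snd (f n)" for n
  have r_pos: "0 < r n" and cont: "continuous_on S (g n)" for n
    using f(1)[of n] by (auto simp: I_def g_def r_def)
  have r_half: "r (Suc n) \<le> r n / 2" and diff: "\<And>z. z \<in> S \<Longrightarrow> norm (g (Suc n) z - g n z) \<le> r n - r (Suc n)"
    and P: "\<And>x. (\<forall>z\<in>S. norm (x z - g (Suc n) z) \<le> r (Suc n)) \<Longrightarrow> P n x" for n
    using f(2)[of n] by (auto simp: Q_def g_def r_def)
  \<comment> \<open>The distances telescope, so all later centres stay in the ball of stage
    \<open>n\<close>.\<close>
  have diff': "norm (g (n + m) z - g n z) \<le> r n - r (n + m)" if "z \<in> S" for n m z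
  proof (induction m)
    case (Suc m)
    have "norm (g (n + Suc m) z - g n z) \<le> norm (g (Suc (n + m)) z - g (n + m) z) + norm (g (n + m) z - g n z)"
      using norm_triangle_ineq[of "g (Suc (n + m)) z - g (n + m) z" "g (n + m) z - g n z"] by simp
    also have "\<dots> \<le> r n - r (n + Suc m)"
      using diff[OF that, of "n + m"] Suc by simp
    finally show ?case .
  qed simp
  have r_pow: "r n \<le> r 0 * (1 / 2) ^ n" for n
  proof (induction n)
    case (Suc n)
    then show ?case using r_half[of n] by simp
  qed simp
  have "(\<lambda>n. r 0 * (1 / 2) ^ n) \<longlonglongrightarrow> r 0 * 0"
    by (intro tendsto_intros LIMSEQ_power_zero) simp
  then have r_0: "r \<longlonglongrightarrow> 0"
    using r_pos r_pow
    by (intro tendsto_sandwich[of "\<lambda>_. 0" r sequentially "\<lambda>n. r 0 * (1 / 2) ^ n"])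
       (auto intro!: always_eventually less_imp_le)
  define x where "x z = lim (\<lambda>n. g n z)" for z
  have x_close: "norm (x z - g n z) \<le> r n" if z: "z \<in> S" for n z
  proof -
    have "Cauchy (\<lambda>n. g n z)"
    proof (rule metric_CauchyI)
      fix e :: real assume "0 < e"
      then obtain N where N: "r N < e / 2"
        using order_tendstoD(2)[OF r_0, of "e / 2"] by (auto simp: eventually_sequentially)
      have "dist (g m z) (g N z) < e / 2" if "m \<ge> N" for m
        using diff'[OF z, of N "m - N"] r_pos[of m] N that by (simp add: dist_norm)
      then have "dist (g m z) (g n z) < e" if "m \<ge> N" "n \<ge> N" for m n
        using that dist_triangle_half_l by blast
      then show "\<exists>M. \<forall>m\<ge>M. \<forall>n\<ge>M. dist (g m z) (g n z) < e" by blast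
    qed
    then have "(\<lambda>m. g m z) \<longlonglongrightarrow> x z"
      unfolding x_def by (simp add: Cauchy_convergent convergent_LIMSEQ_iff[symmetric])
    then have "(\<lambda>m. g (n + m) z) \<longlonglongrightarrow> x z"
      using LIMSEQ_ignore_initial_segment[of _ _ n] by (simp add: add.commute)
    then have "(\<lambda>m. norm (g (n + m) z - g n z)) \<longlonglongrightarrow> norm (x z - g n z)"
      by (intro tendsto_intros)
    moreover have "norm (g (n + m) z - g n z) \<le> r n" for m
      using diff'[OF z, of n m] r_pos[of "n + m"] by linarith
    ultimately show ?thesis
      by (intro LIMSEQ_le_const2) auto
  qed
  have "uniform_limit S g x sequentially"
    unfolding uniform_limit_iff
  proof (intro allI impI)
    fix e :: real assume "0 < e"
    then have "\<forall>\<^sub>F n in sequentially. r n < e"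
      by (rule order_tendstoD(2)[OF r_0])
    then show "\<forall>\<^sub>F n in sequentially. \<forall>z\<in>S. dist (g n z) (x z) < e"
    proof eventually_elim
      case (elim n)
      have "dist (g n z) (x z) < e" if "z \<in> S" for z
        using x_close[OF that, of n] elim by (simp add: dist_norm norm_minus_commute)
      then show ?case by blast
    qed
  qed
  then have "continuous_on S x"
    by (rule uniform_limit_theorem[rotated]) (auto intro: cont always_eventually)
  \<comment> \<open>Property \<open>k\<close> is secured by the ball of stage \<open>Suc k\<close>,
    which contains the limit.\<close>
  moreover have "P k x" for k
    using x_close by (intro P) auto
  ultimately show ?thesis by blast
qed

section \<open>Graphs of Laurent polynomials and the decomposition of \<open>f\<close>\<close>

text \<open>Over nonzero first coordinates the zeros form the graph of
  \<open>poly p z / z ^ m\<close>; clearing the denominator makes the function entire.\<close>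

definition Laurent_graph_poly :: "nat \<Rightarrow> complex poly \<Rightarrow> complex ^ 2 \<Rightarrow> complex" where
  "Laurent_graph_poly m p x = x $ 1 ^ m * x $ 2 - poly p (x $ 1)"

text \<open>For \<open>cmod z = 1\<close> the factor \<open>z ^ m\<close> has modulus 1, so
  smallness of the polynomial means vertical closeness to the Laurent graph. At (1, 0) its value is
  \<open>- poly p 1\<close>, and the constants are those of the k-th term in
  \<open>pluripolar_criterion\<close>.\<close>

lemma continuous_psh_near_Laurent_graph:
  assumes "poly p 1 \<noteq> 0"
  shows "\<exists>\<epsilon>>0. \<exists>h :: complex ^ 2 \<Rightarrow> real. continuous_psh h \<and> (\<forall>x. norm x \<le> real k \<longrightarrow> h x \<le> 0) \<and>
           - ((1 / 2) ^ k) \<le> h (vector [1, 0]) \<and>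
           (\<forall>z w. cmod z = 1 \<longrightarrow> cmod (w - poly p z / z ^ m) \<le> \<epsilon> \<longrightarrow> h (vector [z, w]) \<le> -1)"
proof -
  have 1: "continuous_on UNIV (Laurent_graph_poly m p)"
    unfolding Laurent_graph_poly_def by (intro continuous_intros)
  have 2: "(\<lambda>\<zeta>. Laurent_graph_poly m p (a + \<zeta> *s b)) holomorphic_on UNIV" for a b
    unfolding Laurent_graph_poly_def by (auto intro!: holomorphic_intros)
  have 3: "Laurent_graph_poly m p (vector [1, 0]) \<noteq> 0"
    using assms by (simp add: Laurent_graph_poly_def)
  have eq: "cmod (Laurent_graph_poly m p (vector [z, w])) = cmod (w - poly p z / z ^ m)"
    if "cmod z = 1" for z w
  proof -
    have "z \<noteq> 0" using that by auto
    then have "Laurent_graph_poly m p (vector [z, w]) = z ^ m * (w - poly p z / z ^ m)"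
      by (simp add: Laurent_graph_poly_def field_simps)
    then show ?thesis using that by (simp add: norm_mult norm_power)
  qed
  show ?thesis
    using continuous_psh_near_zero_set[OF 1 2 3, of "(1 / 2) ^ k" "real k"] eq by (simp, metis)
qed

theorem corollary1p3:
  fixes f :: "complex \<Rightarrow> complex"
  assumes "continuous_on {z. cmod z = 1} f"
  shows "\<exists>f1 f2 :: complex \<Rightarrow> complex.
           continuous_on {z. cmod z = 1} f1 \<and> continuous_on {z. cmod z = 1} f2 \<and>
           (\<forall>z\<in>{z. cmod z = 1}. f z = f1 z - f2 z) \<and>
           pluripolar (graph_over {z. cmod z = 1} f1) \<and>
           pluripolar (graph_over {z. cmod z = 1} f2)"
proof -
  let ?S = "{z. cmod z = 1}"
  \<comment> \<open>The k-th requirement of \<open>pluripolar_criterion\<close> for the graph of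
    \<open>x\<close>, with the same base point (1, 0) for every \<open>k\<close>, so that each can
    be secured separately.\<close>
  define good where "good k x \<longleftrightarrow> (\<exists>h :: complex ^ 2 \<Rightarrow> real. continuous_psh h \<and>
      (\<forall>x. norm x \<le> real k \<longrightarrow> h x \<le> 0) \<and> - ((1 / 2) ^ k) \<le> h (vector [1, 0]) \<and>
      (\<forall>z\<in>?S. h (vector [z, x z]) \<le> -1))" for k and x :: "complex \<Rightarrow> complex"
  have pluripolar: "pluripolar (graph_over ?S x)" if "\<And>k. good k x" for x
  proof -
    have "\<exists>h. \<forall>k. continuous_psh (h k) \<and> (\<forall>x. norm x \<le> real k \<longrightarrow> h k x \<le> 0) \<and>
        - ((1 / 2) ^ k) \<le> h k (vector [1, 0] :: complex ^ 2) \<and> (\<forall>z\<in>?S. h k (vector [z, x z]) \<le> -1)"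
      using that unfolding good_def by (intro choice) blast
    then obtain h :: "nat \<Rightarrow> complex ^ 2 \<Rightarrow> real" where
      h: "\<And>k. continuous_psh (h k) \<and> (\<forall>x. norm x \<le> real k \<longrightarrow> h k x \<le> 0) \<and>
        - ((1 / 2) ^ k) \<le> h k (vector [1, 0]) \<and> (\<forall>z\<in>?S. h k (vector [z, x z]) \<le> -1)"
      by blast
    show ?thesis
      by (rule pluripolar_criterion[of h]) (use h in \<open>auto simp: graph_over_def\<close>)
  qed
  \<comment> \<open>Density: near any continuous \<open>g\<close> there is a whole sup-norm ball,
    centred at a Laurent polynomial, of functions satisfying requirement \<open>k\<close>.\<close>
  have approx: "\<exists>L \<epsilon>. continuous_on ?S L \<and> 0 < \<epsilon> \<and> (\<forall>z\<in>?S. cmod (g z - L z) < e) \<and>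
      (\<forall>x. (\<forall>z\<in>?S. cmod (x z - L z) \<le> \<epsilon>) \<longrightarrow> good k x)"
    if g: "continuous_on ?S g" and "0 < e" for g :: "complex \<Rightarrow> complex" and e k
  proof -
    obtain m p where p: "poly p 1 \<noteq> 0" "\<And>z. cmod z = 1 \<Longrightarrow> cmod (g z - poly p z / z ^ m) < e"
      using Laurent_polynomial_approximation[OF g \<open>0 < e\<close>] by blast
    obtain \<epsilon> and h :: "complex ^ 2 \<Rightarrow> real" where h: "0 < \<epsilon>" "continuous_psh h"
      "\<And>x. norm x \<le> real k \<Longrightarrow> h x \<le> 0" "- ((1 / 2) ^ k) \<le> h (vector [1, 0])"
      "\<And>z w. cmod z = 1 \<Longrightarrow> cmod (w - poly p z / z ^ m) \<le> \<epsilon> \<Longrightarrow> h (vector [z, w]) \<le> -1"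
      using continuous_psh_near_Laurent_graph[OF p(1), of k m] by blast
    have "continuous_on ?S (\<lambda>z. poly p z / z ^ m)"
      by (intro continuous_intros) auto
    moreover have "good k x" if "\<forall>z\<in>?S. cmod (x z - poly p z / z ^ m) \<le> \<epsilon>" for x
      unfolding good_def using h that by (intro exI[of _ h]) auto
    ultimately show ?thesis
      using p(2) h(1) by (intro exI[of _ "\<lambda>z. poly p z / z ^ m"] exI[of _ \<epsilon>]) auto
  qed
  have "\<exists>x. continuous_on ?S x \<and> (\<forall>k. good k x \<and> good k (\<lambda>z. x z - f z))"
  proof (rule nested_uniform_approximation)
    fix k and g :: "complex \<Rightarrow> complex" and r :: real
    assume g: "continuous_on ?S g" and r: "0 < r"
    obtain L1 \<epsilon>1 where 1: "continuous_on ?S L1" "0 < \<epsilon>1" "\<And>z. z \<in> ?S \<Longrightarrow> cmod (g z - L1 z) < r / 2"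
      "\<And>x. (\<forall>z\<in>?S. cmod (x z - L1 z) \<le> \<epsilon>1) \<Longrightarrow> good k x"
      using approx[OF g half_gt_zero[OF r], of k] by blast
    \<comment> \<open>The second approximation starts from \<open>L1 - f\<close> and is finer than
      half of \<epsilon>1. So \<open>f + L2\<close> lies well inside the ball around
      \<open>L1\<close>, and a small ball around it meets the requirement both for \<open>x\<close>
      and, after subtracting \<open>f\<close>, for \<open>x - f\<close>.\<close>
    have "continuous_on ?S (\<lambda>z. L1 z - f z)" "0 < min (r / 2) (\<epsilon>1 / 2)"
      using r 1(2) by (auto intro!: continuous_intros 1(1) assms)
    from approx[OF this, of k] obtain L2 \<epsilon>2 where 2: "continuous_on ?S L2" "0 < \<epsilon>2"
      "\<And>z. z \<in> ?S \<Longrightarrow> cmod (L1 z - f z - L2 z) < min (r / 2) (\<epsilon>1 / 2)"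
      "\<And>x. (\<forall>z\<in>?S. cmod (x z - L2 z) \<le> \<epsilon>2) \<Longrightarrow> good k x"
      by blast
    let ?g = "\<lambda>z. f z + L2 z" and ?r = "min (\<epsilon>1 / 2) \<epsilon>2"
    have gL1: "cmod (?g z - L1 z) < min (r / 2) (\<epsilon>1 / 2)" if "z \<in> ?S" for z
      using 2(3)[OF that] norm_minus_commute[of "?g z" "L1 z"] by (simp add: diff_diff_add)
    have "cmod (?g z - g z) \<le> r" if "z \<in> ?S" for z
      using norm_diff_triangle_less[of "?g z" "L1 z" "r / 2" "g z" "r / 2"] gL1[OF that] 1(3)[OF that]
      by (simp add: norm_minus_commute)
    moreover have "good k x \<and> good k (\<lambda>z. x z - f z)" if x: "\<forall>z\<in>?S. cmod (x z - ?g z) \<le> ?r" for x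
    proof
      have "cmod (x z - L1 z) \<le> \<epsilon>1" if "z \<in> ?S" for z
      proof -
        have "cmod (x z - L1 z) \<le> cmod (x z - ?g z) + cmod (?g z - L1 z)"
          using norm_triangle_ineq[of "x z - ?g z" "?g z - L1 z"] by simp
        then show ?thesis using gL1[OF that] x that by fastforce
      qed
      then show "good k x" by (intro 1(4)) blast
      show "good k (\<lambda>z. x z - f z)"
        using x by (intro 2(4)) (auto simp: diff_diff_add)
    qed
    moreover have "continuous_on ?S ?g"
      by (intro continuous_intros 2 assms)
    moreover have "0 < ?r" using 1 2 by simp
    ultimately show "\<exists>g' r'. continuous_on ?S g' \<and> 0 < r' \<and> (\<forall>z\<in>?S. cmod (g' z - g z) \<le> r) \<and>
        (\<forall>x. (\<forall>z\<in>?S. cmod (x z - g' z) \<le> r') \<longrightarrow> good k x \<and> good k (\<lambda>z. x z - f z))"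
      by (intro exI[of _ ?g] exI[of _ ?r]) blast
  qed
  then obtain x where x: "continuous_on ?S x" "\<And>k. good k x" "\<And>k. good k (\<lambda>z. x z - f z)"
    by blast
  have "continuous_on ?S (\<lambda>z. x z - f z)"
    by (intro continuous_intros x assms)
  with x show ?thesis
    by (intro exI[of _ x] exI[of _ "\<lambda>z. x z - f z"]) (auto intro!: pluripolar)
qed

end
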